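(* Let $(\Gamma,\psi)$ and $(\Gamma',\psi')$ be two GBS graphs, and suppose that there is a sequence of slides, swaps and connections going from one to the other (these moves preserve the set of vertices, so the sequence induces a bijection $V(\Gamma)=V(\Gamma')$). Then $(\Gamma,\psi)$ and $(\Gamma',\psi')$ have the same quasi-conjugacy classes and the same linear invariants (under the induced identification of the vertex sets of their affine representations).
   Context: A graph (in the sense of Serre) has a vertex set $V$, an edge set $E$, a fixed-point-free involution $e\mapsto\bar e$ on $E$, an initial-vertex map $\iota:E\to V$, and $\tau(e)=\iota(\bar e)$. A GBS graph $(\Gamma,\psi)$ is a finite connected graph $\Gamma$ together with a function $\psi:E(\Gamma)\to\mathbb Z\setminus\{0\}$. Let $\mathcal P=\mathcal P(\Gamma,\psi)$ be the finite set of primes dividing some $\psi(e)$, and let $\mathbf A=\mathbb Z/2\mathbb Z\oplus\bigoplus_{r\in\mathcal P}\mathbb Z$. For $\mathbf a=(a_0,(a_r)_{r\in\mathcal P})\in\mathbf A$ write $\mathbf a\ge\mathbf 0$ if $a_r\ge0$ for all $r\in\mathcal P$ (no condition on $a_0$); put $\mathbf A^+=\{\mathbf a\in\mathbf A:\mathbf a\ge\mathbf 0\}$ and $\mathrm{supp}(\mathbf a)=\{r\in\mathcal P:a_r\ne0\}$. The affine representation $\Lambda$ of $(\Gamma,\psi)$ is the graph with $V(\Lambda)=V(\Gamma)\times\mathbf A^+$, $E(\Lambda)=E(\Gamma)$ with the same reverse map, and terminal vertices $\tau_\Lambda(e)=(\tau_\Gamma(e),(a_0,(a_r)_r))$ where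 $\psi(e)=(-1)^{a_0}\prod_{r}r^{a_r}$. Below $\iota(e),\tau(e)$ denote endpoints in $\Lambda$. For $p=(v,\mathbf a)\in V(\Lambda)$ and $\mathbf w\in\mathbf A^+$ put $p+\mathbf w=(v,\mathbf a+\mathbf w)$, and write $p\le p'$ if $p'=p+\mathbf w$ for some $\mathbf w\in\mathbf A^+$. An affine path from $p$ to $p'$ is a sequence of edges $(e_1,\dots,e_\ell)$, $\ell\ge0$, for which there are $\mathbf w_1,\dots,\mathbf w_\ell\in\mathbf A^+$ with $\iota(e_1)+\mathbf w_1=p$, $\tau(e_\ell)+\mathbf w_\ell=p'$ and $\tau(e_i)+\mathbf w_i=\iota(e_{i+1})+\mathbf w_{i+1}$ for $1\le i<\ell$ (the empty path goes from $p$ to $p$). Write $p\sim_{\mathrm c}q$ (conjugate) if there is an affine path from $p$ to $q$; $p\preceq_{\mathrm c}q$ if $p\le q'$ for some $q'\sim_{\mathrm c}q$; $p\sim_{\mathrm{qc}}q$ (quasi-conjugate) if $p\preceq_{\mathrm c}q$ and $q\preceq_{\mathrm c}p$. An edge $e$ belongs to the (quasi-)conjugacy class of $\iota(e)$ (equivalently of $\tau(e)$). For a quasi-conjugacy class $Q$ and $p\in Q$ define (independently of $p$) $\mathrm{min}_{\mathrm{qc}}(Q)=\{q\in Q:\text{ for all }q'\in Q\text{ with }q'\le q\text{ one has }q\le q'\}$, $\mathrm{supp}_{\mathrm{qc}}(Q)=\bigcup\{\mathrm{supp}(\mathbf u):\mathbf u\in\mathbf A^+,\ p+\mathbf u\sim_{\mathrm{qc}}p\}$,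 and $\mathrm{lin}_{\mathrm{qc}}(Q)=\{\mathbf w-\mathbf w':\mathbf w,\mathbf w'\in\mathbf A^+,\ p+\mathbf w\sim_{\mathrm c}p+\mathbf w'\sim_{\mathrm c}p\}$. The linear invariants of $(\Gamma,\psi)$ are the following data: (1) the set of primes $\mathcal P(\Gamma,\psi)$; (2) the finite list of quasi-conjugacy classes $Q$ containing at least one edge, each given through $\mathrm{min}_{\mathrm{qc}}(Q),\mathrm{supp}_{\mathrm{qc}}(Q),\mathrm{lin}_{\mathrm{qc}}(Q)$, together with the number of edges $e$ with $\iota(e)\in Q$; (3) the finite list of conjugacy classes $C$ containing at least one edge, together with the number of edges $e$ with $\iota(e)\in C$. Moves, described on the affine representation ($p\,\text{---}\,q$ denotes an edge of $\Lambda$ with endpoints $p,q$; the two edges involved are distinct, all other edges are unchanged, and the vertex set of $\Gamma$ is unchanged): Slide: given edges $p\,\text{---}\,q$ and $r\,\text{---}\,p+\mathbf a$ with $\mathbf a\in\mathbf A^+$, replace the second by $r\,\text{---}\,q+\mathbf a$. Swap: given $p\,\text{---}\,p+\mathbf w_1$ and $q\,\text{---}\,q+\mathbf w_2$ with $\mathbf w_1,\mathbf w_2\in\mathbf A^+$, $p\le q\le p+k_1\mathbf w_1$ and $p\le q\le p+k_2\mathbf w_2$ for some $k_1,k_2\in\mathbb N$, replace them by $q\,\text{---}\,q+\mathbf w_1$ and $p\,\text{---}\,p+\mathbf w_2$. Connection: given $q\,\text{---}\,p+\mathbf w_1$ and $p\,\text{---}\,p+\mathbf w$ with $\mathbf w,\mathbf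 w_1,\mathbf w_2\in\mathbf A^+$ and $\mathbf w_1+\mathbf w_2=k\mathbf w$ for some $k\in\mathbb N$, replace them by $p\,\text{---}\,q+\mathbf w_2$ and $q\,\text{---}\,q+\mathbf w$. *)

theory Defs
  imports
    "HOL-Computational_Algebra.Primes"
    "HOL-Library.Poly_Mapping"
    "HOL-Library.Product_Plus"
    "HOL-Library.Z2"
begin

text \<open>The reverse map, the initial-vertex map and the labels are only meaningful on \<open>edges\<close>.\<close>

record ('v, 'e) gbs =
  verts :: "'v set"
  edges :: "'e set"
  opp :: "'e \<Rightarrow> 'e"
  origin :: "'e \<Rightarrow> 'v"
  psi :: "'e \<Rightarrow> int"

definition terminus :: "('v, 'e) gbs \<Rightarrow> 'e \<Rightarrow> 'v" where
  "terminus G e = origin G (opp G e)"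

definition connected_graph :: "('v, 'e) gbs \<Rightarrow> bool" where
  "connected_graph G \<longleftrightarrow> verts G \<noteq> {} \<and>
     (\<forall>u\<in>verts G. \<forall>v\<in>verts G. (u, v) \<in> {(origin G e, terminus G e) | e. e \<in> edges G}\<^sup>*)"

definition gbs_graph :: "('v, 'e) gbs \<Rightarrow> bool" where
  "gbs_graph G \<longleftrightarrow>
     finite (verts G) \<and> finite (edges G) \<and>
     (\<forall>e\<in>edges G. opp G e \<in> edges G \<and> opp G (opp G e) = e \<and> opp G e \<noteq> e) \<and>
     (\<forall>e\<in>edges G. origin G e \<in> verts G) \<and>
     connected_graph G \<and>
     (\<forall>e\<in>edges G. psi G e \<noteq> 0)"

definition gbs_iso :: "('v \<Rightarrow> 'w) \<Rightarrow> ('e \<Rightarrow> 'f) \<Rightarrow> ('v, 'e) gbs \<Rightarrow> ('w, 'f) gbs \<Rightarrow> bool" where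
  "gbs_iso \<phi> \<epsilon> G G' \<longleftrightarrow>
     bij_betw \<phi> (verts G) (verts G') \<and> bij_betw \<epsilon> (edges G) (edges G') \<and>
     (\<forall>e\<in>edges G. \<epsilon> (opp G e) = opp G' (\<epsilon> e) \<and>
                   origin G' (\<epsilon> e) = \<phi> (origin G e) \<and> psi G' (\<epsilon> e) = psi G e)"

text \<open>
  All the groups \<open>\<int>/2 \<oplus> \<Oplus>\<^bsub>r\<in>P\<^esub> \<int>\<close> are taken inside the single type \<open>avec\<close>, in which the
  exponents are indexed by all natural numbers; the condition that only primes of the given
  GBS graph occur is part of \<open>Aplus\<close>. Poly_Mapping and the product type may carry
  orders of their own; the order used here is \<open>pt_le\<close> below.
\<close>

type_synonym avec = "bit \<times> (nat \<Rightarrow>\<^sub>0 int)"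
type_synonym 'v pt = "'v \<times> avec"

definition gbs_primes :: "('v, 'e) gbs \<Rightarrow> nat set" where
  "gbs_primes G = {r. prime r \<and> (\<exists>e\<in>edges G. int r dvd psi G e)}"

definition Aplus :: "('v, 'e) gbs \<Rightarrow> avec set" where
  "Aplus G = {a. Poly_Mapping.keys (snd a) \<subseteq> gbs_primes G \<and>
                 (\<forall>r\<in>gbs_primes G. 0 \<le> Poly_Mapping.lookup (snd a) r)}"

definition supp :: "avec \<Rightarrow> nat set" where
  "supp a = Poly_Mapping.keys (snd a)"

definition scale :: "nat \<Rightarrow> avec \<Rightarrow> avec" where
  "scale k w = (\<Sum>i<k. w)"

definition vec_of_int :: "int \<Rightarrow> avec" where
  "vec_of_int n = (if n < 0 then 1 else 0,
     \<Sum>r\<in>prime_factors (nat \<bar>n\<bar>). Poly_Mapping.single r (int (multiplicity r (nat \<bar>n\<bar>))))"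

lemma lookup_vec_of_int:
  "Poly_Mapping.lookup (snd (vec_of_int n)) r =
     (if r \<in> prime_factors (nat \<bar>n\<bar>) then int (multiplicity r (nat \<bar>n\<bar>)) else 0)"
  by (simp add: vec_of_int_def lookup_sum lookup_single when_def)

lemma vec_of_int_correct:
  assumes "n \<noteq> 0" "finite P" "prime_factors (nat \<bar>n\<bar>) \<subseteq> P"
  shows "n = (if fst (vec_of_int n) = 1 then - 1 else 1) *
              (\<Prod>r\<in>P. int r ^ nat (Poly_Mapping.lookup (snd (vec_of_int n)) r))"
proof -
  have "(\<Prod>r\<in>P. int r ^ nat (Poly_Mapping.lookup (snd (vec_of_int n)) r)) =
        (\<Prod>r\<in>prime_factors (nat \<bar>n\<bar>). int r ^ multiplicity r (nat \<bar>n\<bar>))"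
    using assms by (intro prod.mono_neutral_cong_right) (auto simp: lookup_vec_of_int)
  also have "\<dots> = int (\<Prod>r\<in>prime_factors (nat \<bar>n\<bar>). r ^ multiplicity r (nat \<bar>n\<bar>))"
    by simp
  also have "\<dots> = \<bar>n\<bar>"
    using assms(1) by (subst prod_prime_factors) auto
  finally show ?thesis
    by (simp add: vec_of_int_def)
qed

definition aff_verts :: "('v, 'e) gbs \<Rightarrow> 'v pt set" where
  "aff_verts G = verts G \<times> Aplus G"

definition aff_term :: "('v, 'e) gbs \<Rightarrow> 'e \<Rightarrow> 'v pt" where
  "aff_term G e = (terminus G e, vec_of_int (psi G e))"

definition aff_init :: "('v, 'e) gbs \<Rightarrow> 'e \<Rightarrow> 'v pt" where
  "aff_init G e = aff_term G (opp G e)"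

definition translate :: "'v pt \<Rightarrow> avec \<Rightarrow> 'v pt"  (infixl \<open>\<oplus>\<close> 65) where
  "p \<oplus> w = (fst p, snd p + w)"

definition pt_le :: "('v, 'e) gbs \<Rightarrow> 'v pt \<Rightarrow> 'v pt \<Rightarrow> bool" where
  "pt_le G p p' \<longleftrightarrow> (\<exists>w\<in>Aplus G. p' = p \<oplus> w)"

definition affine_path :: "('v, 'e) gbs \<Rightarrow> 'v pt \<Rightarrow> 'e list \<Rightarrow> 'v pt \<Rightarrow> bool" where
  "affine_path G p es p' \<longleftrightarrow>
     p \<in> aff_verts G \<and> p' \<in> aff_verts G \<and> set es \<subseteq> edges G \<and>
     (if es = [] then p' = p
      else \<exists>ws. length ws = length es \<and> set ws \<subseteq> Aplus G \<and>
             aff_init G (hd es) \<oplus> hd ws = p \<and>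
             aff_term G (last es) \<oplus> last ws = p' \<and>
             (\<forall>i. Suc i < length es \<longrightarrow>
                aff_term G (es ! i) \<oplus> ws ! i = aff_init G (es ! Suc i) \<oplus> ws ! Suc i))"

definition conj :: "('v, 'e) gbs \<Rightarrow> 'v pt \<Rightarrow> 'v pt \<Rightarrow> bool" where
  "conj G p q \<longleftrightarrow> (\<exists>es. affine_path G p es q)"

definition conj_le :: "('v, 'e) gbs \<Rightarrow> 'v pt \<Rightarrow> 'v pt \<Rightarrow> bool" where
  "conj_le G p q \<longleftrightarrow> p \<in> aff_verts G \<and> (\<exists>q'. conj G q' q \<and> pt_le G p q')"

definition qconj :: "('v, 'e) gbs \<Rightarrow> 'v pt \<Rightarrow> 'v pt \<Rightarrow> bool" where
  "qconj G p q \<longleftrightarrow> conj_le G p q \<and> conj_le G q p"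

definition conj_classes :: "('v, 'e) gbs \<Rightarrow> 'v pt set set" where
  "conj_classes G = aff_verts G // {(p, q). conj G p q}"

definition qc_classes :: "('v, 'e) gbs \<Rightarrow> 'v pt set set" where
  "qc_classes G = aff_verts G // {(p, q). qconj G p q}"

definition min_qc :: "('v, 'e) gbs \<Rightarrow> 'v pt set \<Rightarrow> 'v pt set" where
  "min_qc G Q = {q \<in> Q. \<forall>q'\<in>Q. pt_le G q' q \<longrightarrow> pt_le G q q'}"

text \<open>The next two sets do not depend on the point of \<open>Q\<close> that is selected.\<close>

definition supp_qc :: "('v, 'e) gbs \<Rightarrow> 'v pt set \<Rightarrow> nat set" where
  "supp_qc G Q = (let p = (SOME p. p \<in> Q) in
     \<Union> {supp u | u. u \<in> Aplus G \<and> qconj G (p \<oplus> u) p})"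

definition lin_qc :: "('v, 'e) gbs \<Rightarrow> 'v pt set \<Rightarrow> avec set" where
  "lin_qc G Q = (let p = (SOME p. p \<in> Q) in
     {w - w' | w w'. w \<in> Aplus G \<and> w' \<in> Aplus G \<and>
        conj G (p \<oplus> w) (p \<oplus> w') \<and> conj G (p \<oplus> w') p})"

definition edges_in :: "('v, 'e) gbs \<Rightarrow> 'v pt set \<Rightarrow> 'e set" where
  "edges_in G X = {e \<in> edges G. aff_init G e \<in> X}"

type_synonym 'v lin_inv =
  "nat set \<times> ('v pt set \<times> 'v pt set \<times> nat set \<times> avec set \<times> nat) set \<times> ('v pt set \<times> nat) set"

definition linear_invariants :: "('v, 'e) gbs \<Rightarrow> 'v lin_inv" where
  "linear_invariants G =
     (gbs_primes G,
      {(Q, min_qc G Q, supp_qc G Q, lin_qc G Q, card (edges_in G Q)) | Q.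
          Q \<in> qc_classes G \<and> edges_in G Q \<noteq> {}},
      {(C, card (edges_in G C)) | C. C \<in> conj_classes G \<and> edges_in G C \<noteq> {}})"

definition map_pt :: "('v \<Rightarrow> 'w) \<Rightarrow> 'v pt \<Rightarrow> 'w pt" where
  "map_pt \<phi> = map_prod \<phi> id"

definition map_lin_inv :: "('v \<Rightarrow> 'w) \<Rightarrow> 'v lin_inv \<Rightarrow> 'w lin_inv" where
  "map_lin_inv \<phi> = (\<lambda>(P, QS, CS).
     (P,
      (\<lambda>(Q, M, S, L, n). (map_pt \<phi> ` Q, map_pt \<phi> ` M, S, L, n)) ` QS,
      (\<lambda>(C, n). (map_pt \<phi> ` C, n)) ` CS))"

definition joins :: "('v, 'e) gbs \<Rightarrow> 'e \<Rightarrow> 'v pt \<Rightarrow> 'v pt \<Rightarrow> bool" where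
  "joins G e p q \<longleftrightarrow> e \<in> edges G \<and> aff_init G e = p \<and> aff_term G e = q"

definition distinct_edges :: "('v, 'e) gbs \<Rightarrow> 'e \<Rightarrow> 'e \<Rightarrow> bool" where
  "distinct_edges G e f \<longleftrightarrow> f \<noteq> e \<and> f \<noteq> opp G e"

text \<open>
  A replaced edge keeps its name and only its endpoints in the affine representation change.
  Since \<open>D\<close> is treated together with its reverses, comparing terminal vertices also
  compares initial ones.
\<close>

definition unchanged_outside :: "'e set \<Rightarrow> ('v, 'e) gbs \<Rightarrow> ('v, 'e) gbs \<Rightarrow> bool" where
  "unchanged_outside D G G' \<longleftrightarrow>
     verts G' = verts G \<and> edges G' = edges G \<and>
     (\<forall>e\<in>edges G. opp G' e = opp G e) \<and>
     (\<forall>e\<in>edges G - (D \<union> opp G ` D). aff_term G' e = aff_term G e)"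

definition slide_move :: "('v, 'e) gbs \<Rightarrow> ('v, 'e) gbs \<Rightarrow> bool" where
  "slide_move G G' \<longleftrightarrow> (\<exists>e f p q r. \<exists>a\<in>Aplus G.
     distinct_edges G e f \<and> unchanged_outside {f} G G' \<and>
     joins G e p q \<and> joins G f r (p \<oplus> a) \<and>
     joins G' f r (q \<oplus> a))"

definition swap_move :: "('v, 'e) gbs \<Rightarrow> ('v, 'e) gbs \<Rightarrow> bool" where
  "swap_move G G' \<longleftrightarrow> (\<exists>e f p q k1 k2. \<exists>w1\<in>Aplus G. \<exists>w2\<in>Aplus G.
     distinct_edges G e f \<and> unchanged_outside {e, f} G G' \<and>
     joins G e p (p \<oplus> w1) \<and> joins G f q (q \<oplus> w2) \<and>
     pt_le G p q \<and> pt_le G q (p \<oplus> scale k1 w1) \<and> pt_le G q (p \<oplus> scale k2 w2) \<and>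
     joins G' e q (q \<oplus> w1) \<and> joins G' f p (p \<oplus> w2))"

definition connection_move :: "('v, 'e) gbs \<Rightarrow> ('v, 'e) gbs \<Rightarrow> bool" where
  "connection_move G G' \<longleftrightarrow> (\<exists>e f p q k. \<exists>w\<in>Aplus G. \<exists>w1\<in>Aplus G. \<exists>w2\<in>Aplus G.
     distinct_edges G e f \<and> unchanged_outside {e, f} G G' \<and>
     joins G e q (p \<oplus> w1) \<and> joins G f p (p \<oplus> w) \<and>
     w1 + w2 = scale k w \<and>
     joins G' e p (q \<oplus> w2) \<and> joins G' f q (q \<oplus> w))"

definition gbs_move :: "('v, 'e) gbs \<Rightarrow> ('v, 'e) gbs \<Rightarrow> bool" where
  "gbs_move G G' \<longleftrightarrow> gbs_graph G \<and> gbs_graph G' \<and>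
     (slide_move G G' \<or> swap_move G G' \<or> connection_move G G')"

text \<open>
  Moves go from \<open>G\<close> to \<open>G'\<close> inducing \<open>\<phi>\<close> on vertices: performing the moves on \<open>G\<close>, with vertex
  and edge names kept, yields a GBS graph isomorphic to \<open>G'\<close> through \<open>\<phi>\<close> (and some bijection
  of edges).
\<close>

definition moves_inducing :: "('v \<Rightarrow> 'w) \<Rightarrow> ('v, 'e) gbs \<Rightarrow> ('w, 'f) gbs \<Rightarrow> bool" where
  "moves_inducing \<phi> G G' \<longleftrightarrow> (\<exists>H \<epsilon>. gbs_move\<^sup>*\<^sup>* G H \<and> gbs_iso \<phi> \<epsilon> H G')"

end

theory Submission
  imports Defs "HOL-Combinatorics.Transposition"
begin

text \<open>
  Slides, swaps and connections change edges, but none of them changes the set of primes or the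
  conjugacy relation on the vertices of the affine representation. Everything in the linear
  invariants except the edge counts is defined from these two data and the set of vertices, so
  only the edge counts, which also decide which classes are listed, need a further argument.

  Conjugacy is the equivalence relation generated by all translates of all edges by vectors of
  \<open>Aplus\<close> (\<open>conj_iff_aff_steps\<close>). To see that a move does not lose conjugate pairs it is therefore
  enough to join the endpoints of each removed edge by an affine path of the new graph
  (\<open>conj_imp_conj_if_ends\<close>). Write \<open>\<sim>\<close> for conjugacy in the new
  graph, and name the points and vectors as in the definitions of the moves.

  \<^item> After a slide, \<open>r \<sim> q + a \<sim> p + a\<close>.

  \<^item> After a swap, going round the loop at \<open>p\<close> sufficiently often reaches a point above \<open>q\<close>,
    where the loop at \<open>q\<close> can be used: \<open>p \<sim> p + k\<^sub>2 w\<^sub>2 \<sim> p + k\<^sub>2 w\<^sub>2 + w\<^sub>1 \<sim> p + w\<^sub>1\<close>. The other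
    removed loop, at \<open>q\<close>, is a translate of the new loop at \<open>p\<close>.

  \<^item> After a connection, \<open>q \<sim> q + k w = q + w\<^sub>2 + w\<^sub>1 \<sim> p + w\<^sub>1\<close> and
    \<open>p \<sim> q + w\<^sub>2 \<sim> q + w\<^sub>2 + w \<sim> p + w\<close>.

  No new conjugate pairs arise either, because the inverse of a move is a move of the same kind.

  For the edge counts, some bijection of the edges must send every edge to an edge in the same
  conjugacy class. A slide leaves each edge in its class. In a swap the two loops may lie in
  different conjugacy classes, and in a connection the two edges may do so too, but in both cases
  each edge moves to the class of the other one, and exchanging their names gives the bijection
  (\<open>conj_preserving_exchange\<close>).

  The relation \<open>conj_preserving\<close> collects these facts. Isomorphisms satisfy it too, it composes,
  and it transports all linear invariants (\<open>preserved_linear_invariants\<close>). The supports and the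
  linear parts are defined at a selected point of a class, and an isomorphism need not respect
  the selection; so their independence of the point is needed as well (\<open>supp_qc_eq\<close>, \<open>lin_qc_eq\<close>).
\<close>

section \<open>Points of the affine representation\<close>

lemma translate_translate [simp]: "p \<oplus> a \<oplus> b = p \<oplus> (a + b)"
  by (simp add: translate_def add.assoc)

lemma translate_0 [simp]: "p \<oplus> 0 = p"
  by (simp add: translate_def)

lemma scale_0 [simp]: "scale 0 w = 0" and scale_Suc [simp]: "scale (Suc k) w = scale k w + w"
  by (simp_all add: scale_def)

lemma Aplus_0 [simp]: "0 \<in> Aplus G"
  by (simp add: Aplus_def)

lemma Aplus_add [simp]: "a \<in> Aplus G \<Longrightarrow> b \<in> Aplus G \<Longrightarrow> a + b \<in> Aplus G"
  using Poly_Mapping.keys_add[of "snd a" "snd b"] by (auto simp: Aplus_def lookup_add)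

lemma Aplus_scale [simp]: "w \<in> Aplus G \<Longrightarrow> scale k w \<in> Aplus G"
  by (induction k) auto

lemma aff_verts_translate [simp]: "p \<in> aff_verts G \<Longrightarrow> w \<in> Aplus G \<Longrightarrow> p \<oplus> w \<in> aff_verts G"
  by (cases p) (auto simp: aff_verts_def translate_def)

text \<open>Entries of vectors in \<open>Aplus\<close> are nonnegative, so no cancellation occurs.\<close>

lemma supp_add:
  assumes "a \<in> Aplus G" "b \<in> Aplus G"
  shows "supp (a + b) = supp a \<union> supp b"
proof -
  have nonneg: "0 \<le> Poly_Mapping.lookup (snd x) r" if "x \<in> Aplus G" for x r
    using that by (cases "r \<in> Poly_Mapping.keys (snd x)") (auto simp: Aplus_def in_keys_iff)
  show ?thesis
    using nonneg[OF assms(1)] nonneg[OF assms(2)]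
    by (auto simp: supp_def in_keys_iff lookup_add add_nonneg_eq_0_iff)
qed

lemma supp_scale_subset: "w \<in> Aplus G \<Longrightarrow> supp (scale k w) \<subseteq> supp w"
  by (induction k) (simp_all add: supp_add[where G = G], simp add: supp_def)

lemma supp_vec_of_int: "supp (vec_of_int n) = prime_factors (nat \<bar>n\<bar>)"
  by (auto simp: supp_def in_keys_iff lookup_vec_of_int prime_factors_multiplicity split: if_splits)

text \<open>
  This reads the primes off the affine representation, which is the only thing that the moves
  describe.
\<close>

lemma gbs_primes_eq_supp:
  assumes "gbs_graph G"
  shows "gbs_primes G = (\<Union>e\<in>edges G. supp (snd (aff_term G e)))"
proof -
  have "r \<in> prime_factors (nat \<bar>psi G e\<bar>) \<longleftrightarrow> prime r \<and> int r dvd psi G e"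
    if "e \<in> edges G" for r e
  proof -
    have "psi G e \<noteq> 0" using assms that by (simp add: gbs_graph_def)
    then show ?thesis
      using int_dvd_int_iff[of r "nat \<bar>psi G e\<bar>"] by (auto simp: in_prime_factors_iff)
  qed
  then show ?thesis
    by (auto simp: gbs_primes_def aff_term_def supp_vec_of_int)
qed

lemma supp_subset_primes: "p \<in> aff_verts G \<Longrightarrow> supp (snd p) \<subseteq> gbs_primes G"
  by (auto simp: aff_verts_def Aplus_def supp_def)

lemma opp_edges: "gbs_graph G \<Longrightarrow> e \<in> edges G \<Longrightarrow> opp G e \<in> edges G"
  and opp_opp: "gbs_graph G \<Longrightarrow> e \<in> edges G \<Longrightarrow> opp G (opp G e) = e"
  and opp_neq: "gbs_graph G \<Longrightarrow> e \<in> edges G \<Longrightarrow> opp G e \<noteq> e"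
  by (auto simp: gbs_graph_def)

lemma aff_init_opp [simp]:
  "gbs_graph G \<Longrightarrow> e \<in> edges G \<Longrightarrow> aff_init G (opp G e) = aff_term G e"
  by (simp add: aff_init_def opp_opp)

lemma aff_term_opp [simp]: "aff_term G (opp G e) = aff_init G e"
  by (simp add: aff_init_def)

lemma aff_term_in [simp]:
  assumes "gbs_graph G" "e \<in> edges G"
  shows "aff_term G e \<in> aff_verts G"
proof -
  have "supp (vec_of_int (psi G e)) \<subseteq> gbs_primes G"
    using assms unfolding gbs_primes_eq_supp[OF assms(1)] aff_term_def by auto
  moreover have "terminus G e \<in> verts G"
    using assms by (simp add: gbs_graph_def terminus_def)
  ultimately show ?thesis
    by (auto simp: aff_term_def aff_verts_def Aplus_def supp_def lookup_vec_of_int)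
qed

lemma aff_init_in [simp]: "gbs_graph G \<Longrightarrow> e \<in> edges G \<Longrightarrow> aff_init G e \<in> aff_verts G"
  unfolding aff_init_def by (simp add: opp_edges del: aff_term_opp)

lemma joins_verts:
  assumes "gbs_graph G" "joins G e p q"
  shows "p \<in> aff_verts G" "q \<in> aff_verts G"
  using assms by (auto simp: joins_def)

section \<open>Conjugacy and quasi-conjugacy\<close>

text \<open>
  Replacing lists of edges by the closure of this relation gives induction along affine paths
  and reduces the symmetry and the translation invariance of conjugacy to single edges.
\<close>

definition aff_step :: "('v, 'e) gbs \<Rightarrow> 'v pt \<Rightarrow> 'v pt \<Rightarrow> bool" where
  "aff_step G p q \<longleftrightarrow> (\<exists>e\<in>edges G. \<exists>w\<in>Aplus G. p = aff_init G e \<oplus> w \<and> q = aff_term G e \<oplus> w)"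

lemma affine_path_Nil: "affine_path G p [] q \<longleftrightarrow> p \<in> aff_verts G \<and> q = p"
  by (auto simp: affine_path_def)

text \<open>
  The recursive form of affine paths: it replaces the list of translation vectors and the index
  conditions by one vector for the first edge.
\<close>

lemma affine_path_Cons:
  assumes "gbs_graph G"
  shows "affine_path G p (e # es) q \<longleftrightarrow>
    e \<in> edges G \<and> (\<exists>w\<in>Aplus G. p = aff_init G e \<oplus> w \<and> affine_path G (aff_term G e \<oplus> w) es q)"
proof (cases es)
  case Nil
  show ?thesis
    using assms by (auto simp: Nil affine_path_def length_Suc_conv intro!: exI[of _ "[_]"])
next
  case (Cons f fs)
  show ?thesis
  proof
    assume "affine_path G p (e # es) q"
    then obtain us where us: "length us = length (e # es)" "set us \<subseteq> Aplus G"
      and e: "e \<in> edges G" "set es \<subseteq> edges G" "q \<in> aff_verts G"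
      and ends: "aff_init G e \<oplus> hd us = p" "aff_term G (last es) \<oplus> last us = q"
      and glue: "\<And>i. Suc i < length (e # es) \<Longrightarrow>
        aff_term G ((e # es) ! i) \<oplus> us ! i = aff_init G ((e # es) ! Suc i) \<oplus> us ! Suc i"
      unfolding affine_path_def using Cons by auto
    then obtain w ws where ws: "us = w # ws" "ws \<noteq> []"
      using Cons by (cases us; cases "tl us") auto
    have "aff_term G e \<oplus> w = aff_init G (hd es) \<oplus> hd ws"
      using glue[of 0] ws Cons by (simp add: hd_conv_nth)
    moreover have "aff_term G e \<oplus> w \<in> aff_verts G"
      using e us ws assms by simp
    ultimately have "affine_path G (aff_term G e \<oplus> w) es q"
      using us e ends ws glue[of "Suc i" for i] Cons
      by (auto simp: affine_path_def intro!: exI[of _ ws])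
    then show "e \<in> edges G \<and>
        (\<exists>w\<in>Aplus G. p = aff_init G e \<oplus> w \<and> affine_path G (aff_term G e \<oplus> w) es q)"
      using us e ends ws by auto
  next
    assume "e \<in> edges G \<and>
        (\<exists>w\<in>Aplus G. p = aff_init G e \<oplus> w \<and> affine_path G (aff_term G e \<oplus> w) es q)"
    then obtain w where w: "w \<in> Aplus G" "e \<in> edges G" "p = aff_init G e \<oplus> w"
      and path: "affine_path G (aff_term G e \<oplus> w) es q" by blast
    from path obtain ws where ws: "length ws = length es" "set ws \<subseteq> Aplus G"
      and ends: "aff_init G (hd es) \<oplus> hd ws = aff_term G e \<oplus> w"
        "aff_term G (last es) \<oplus> last ws = q"
      and glue: "\<forall>i. Suc i < length es \<longrightarrow>
             aff_term G (es ! i) \<oplus> ws ! i = aff_init G (es ! Suc i) \<oplus> ws ! Suc i"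
      unfolding affine_path_def using Cons by auto
    have "ws \<noteq> []" using ws Cons by auto
    have "aff_term G ((e # es) ! i) \<oplus> (w # ws) ! i =
        aff_init G ((e # es) ! Suc i) \<oplus> (w # ws) ! Suc i" if "Suc i < length (e # es)" for i
      using that glue ends(1) \<open>ws \<noteq> []\<close> Cons by (cases i) (auto simp: hd_conv_nth)
    moreover have "set es \<subseteq> edges G" "q \<in> aff_verts G"
      using path by (simp_all add: affine_path_def)
    ultimately show "affine_path G p (e # es) q"
      using w ws ends(2) \<open>ws \<noteq> []\<close> Cons assms unfolding affine_path_def
      by (auto intro!: exI[of _ "w # ws"])
  qed
qed

lemma conj_iff_aff_steps:
  assumes "gbs_graph G"
  shows "conj G p q \<longleftrightarrow> p \<in> aff_verts G \<and> (aff_step G)\<^sup>*\<^sup>* p q"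
proof
  have "p \<in> aff_verts G \<and> (aff_step G)\<^sup>*\<^sup>* p q" if "affine_path G p es q" for es
    using that
  proof (induction es arbitrary: p)
    case Nil
    then show ?case by (simp add: affine_path_Nil)
  next
    case (Cons e es)
    then obtain w where w: "e \<in> edges G" "w \<in> Aplus G" "p = aff_init G e \<oplus> w"
      "affine_path G (aff_term G e \<oplus> w) es q"
      using affine_path_Cons[OF assms] by blast
    note w(4)[THEN Cons.IH]
    moreover have "aff_step G p (aff_term G e \<oplus> w)"
      using w by (auto simp: aff_step_def)
    ultimately show ?case
      using w assms by (auto intro: converse_rtranclp_into_rtranclp)
  qed
  then show "conj G p q \<Longrightarrow> p \<in> aff_verts G \<and> (aff_step G)\<^sup>*\<^sup>* p q"
    by (auto simp: conj_def)
  assume "p \<in> aff_verts G \<and> (aff_step G)\<^sup>*\<^sup>* p q"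
  then have "(aff_step G)\<^sup>*\<^sup>* p q" "p \<in> aff_verts G" by auto
  then show "conj G p q"
  proof (induction rule: converse_rtranclp_induct)
    case base
    then show ?case by (auto simp: conj_def affine_path_Nil intro!: exI[of _ "[]"])
  next
    case (step y z)
    from \<open>aff_step G y z\<close> obtain e w where ew: "e \<in> edges G" "w \<in> Aplus G"
      "y = aff_init G e \<oplus> w" "z = aff_term G e \<oplus> w"
      by (auto simp: aff_step_def)
    with step assms obtain es where "affine_path G z es q"
      by (auto simp: conj_def)
    with ew assms have "affine_path G y (e # es) q"
      by (auto simp: affine_path_Cons)
    then show ?case by (auto simp: conj_def)
  qed
qed

lemma conj_verts: "conj G p q \<Longrightarrow> p \<in> aff_verts G" "conj G p q \<Longrightarrow> q \<in> aff_verts G"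
  unfolding conj_def affine_path_def by blast+

lemma conj_refl: "p \<in> aff_verts G \<Longrightarrow> conj G p p"
  unfolding conj_def using affine_path_Nil by blast

lemma conj_trans: "gbs_graph G \<Longrightarrow> conj G p q \<Longrightarrow> conj G q r \<Longrightarrow> conj G p r"
  unfolding conj_iff_aff_steps by (blast intro: rtranclp_trans)

lemma aff_step_sym: "gbs_graph G \<Longrightarrow> aff_step G p q \<Longrightarrow> aff_step G q p"
  unfolding aff_step_def by (metis aff_init_opp aff_term_opp opp_edges)

lemma conj_sym:
  assumes "gbs_graph G" "conj G p q"
  shows "conj G q p"
proof -
  have "symp (aff_step G)"
    using aff_step_sym[OF assms(1)] by (blast intro: sympI)
  then have "symp (aff_step G)\<^sup>*\<^sup>*" by (rule symp_rtranclp)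
  then have "(aff_step G)\<^sup>*\<^sup>* q p"
    using assms by (simp add: conj_iff_aff_steps sympD)
  then show ?thesis
    using assms conj_verts(2)[OF assms(2)] by (simp add: conj_iff_aff_steps)
qed

lemma conj_joins:
  assumes "gbs_graph G" "joins G e p q"
  shows "conj G p q"
proof -
  have "aff_step G p q"
    using assms(2) unfolding joins_def aff_step_def by (metis Aplus_0 translate_0)
  then show ?thesis
    using joins_verts[OF assms] by (simp add: conj_iff_aff_steps[OF assms(1)])
qed

lemma aff_step_translate: "w \<in> Aplus G \<Longrightarrow> aff_step G p q \<Longrightarrow> aff_step G (p \<oplus> w) (q \<oplus> w)"
  unfolding aff_step_def by (metis Aplus_add translate_translate)

lemma conj_translate:
  assumes "gbs_graph G" "w \<in> Aplus G" "conj G p q"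
  shows "conj G (p \<oplus> w) (q \<oplus> w)"
proof -
  have "(aff_step G)\<^sup>*\<^sup>* p q" using assms by (simp add: conj_iff_aff_steps)
  then have "(aff_step G)\<^sup>*\<^sup>* (p \<oplus> w) (q \<oplus> w)"
    by induction (auto intro: rtranclp.rtrancl_into_rtrancl aff_step_translate[OF assms(2)])
  then show ?thesis using assms conj_verts by (simp add: conj_iff_aff_steps)
qed

text \<open>
  A loop can be used again after each turn, because translates of affine paths are affine paths.
\<close>

lemma conj_scale:
  assumes "gbs_graph G" "w \<in> Aplus G" "conj G p (p \<oplus> w)"
  shows "conj G p (p \<oplus> scale k w)"
proof (induction k)
  case 0
  then show ?case using assms by (simp add: conj_refl conj_verts(1))
next
  case (Suc k)
  have "conj G (p \<oplus> w) (p \<oplus> scale k w \<oplus> w)"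
    using assms Suc by (intro conj_translate)
  with assms show ?case by (auto intro: conj_trans)
qed

lemma conj_le_iff:
  "conj_le G p q \<longleftrightarrow> p \<in> aff_verts G \<and> (\<exists>w\<in>Aplus G. conj G (p \<oplus> w) q)"
  unfolding conj_le_def pt_le_def by blast

lemma conj_le_translate:
  assumes "gbs_graph G" "w \<in> Aplus G" "conj_le G p q"
  shows "conj_le G (p \<oplus> w) (q \<oplus> w)"
proof -
  from assms(3) obtain a where a: "a \<in> Aplus G" "conj G (p \<oplus> a) q" "p \<in> aff_verts G"
    by (auto simp: conj_le_iff)
  then have "conj G (p \<oplus> w \<oplus> a) (q \<oplus> w)"
    using conj_translate[OF assms(1,2), of "p \<oplus> a" q] by (simp add: add.commute)
  then show ?thesis using a assms by (auto simp: conj_le_iff)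
qed

lemma conj_imp_conj_le: "conj G p q \<Longrightarrow> conj_le G p q"
  unfolding conj_le_iff by (metis Aplus_0 conj_verts(1) translate_0)

lemma conj_le_trans:
  assumes "gbs_graph G" "conj_le G p q" "conj_le G q r"
  shows "conj_le G p r"
proof -
  from assms obtain a b where ab: "p \<in> aff_verts G" "a \<in> Aplus G" "conj G (p \<oplus> a) q"
    "b \<in> Aplus G" "conj G (q \<oplus> b) r"
    by (auto simp: conj_le_iff)
  then have "conj G (p \<oplus> (a + b)) r"
    using conj_trans[OF assms(1) conj_translate[OF assms(1) ab(4,3)] ab(5)] by simp
  with ab show ?thesis by (auto simp: conj_le_iff)
qed

lemma qconj_verts: "qconj G p q \<Longrightarrow> p \<in> aff_verts G" "qconj G p q \<Longrightarrow> q \<in> aff_verts G"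
  by (auto simp: qconj_def conj_le_def)

lemma conj_imp_qconj: "gbs_graph G \<Longrightarrow> conj G p q \<Longrightarrow> qconj G p q"
  by (auto simp: qconj_def intro: conj_imp_conj_le conj_sym)

lemma qconj_sym: "qconj G p q \<Longrightarrow> qconj G q p"
  by (auto simp: qconj_def)

lemma qconj_trans: "gbs_graph G \<Longrightarrow> qconj G p q \<Longrightarrow> qconj G q r \<Longrightarrow> qconj G p r"
  by (auto simp: qconj_def intro: conj_le_trans)

lemma equiv_qconj: "gbs_graph G \<Longrightarrow> equiv (aff_verts G) {(p, q). qconj G p q}"
  by (auto intro!: equivI refl_onI symI transI
      intro: conj_refl conj_imp_qconj qconj_sym qconj_trans dest: qconj_verts)

lemma qc_class_subset: "gbs_graph G \<Longrightarrow> Q \<in> qc_classes G \<Longrightarrow> Q \<subseteq> aff_verts G"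
  by (auto simp: qc_classes_def quotient_def dest: qconj_verts)

lemma qc_class_conj_closed:
  "gbs_graph G \<Longrightarrow> Q \<in> qc_classes G \<Longrightarrow> p \<in> Q \<Longrightarrow> conj G p q \<Longrightarrow> q \<in> Q"
  by (auto simp: qc_classes_def quotient_def intro: qconj_trans conj_imp_qconj)

lemma conj_class_subset: "gbs_graph G \<Longrightarrow> C \<in> conj_classes G \<Longrightarrow> C \<subseteq> aff_verts G"
  by (auto simp: conj_classes_def quotient_def dest: conj_verts)

lemma conj_class_conj_closed:
  "gbs_graph G \<Longrightarrow> C \<in> conj_classes G \<Longrightarrow> p \<in> C \<Longrightarrow> conj G p q \<Longrightarrow> q \<in> C"
  by (auto simp: conj_classes_def quotient_def intro: conj_trans)

lemma qc_class_qconj: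
  assumes "gbs_graph G" "Q \<in> qc_classes G" "p \<in> Q" "q \<in> Q"
  shows "qconj G p q"
  using quotient_eq_iff[OF equiv_qconj[OF assms(1)] _ _ assms(3,4)] assms(2)
  by (simp add: qc_classes_def)

section \<open>Independence of the base point\<close>

definition supp_at :: "('v, 'e) gbs \<Rightarrow> 'v pt \<Rightarrow> nat set" where
  "supp_at G p = \<Union> {supp u | u. u \<in> Aplus G \<and> qconj G (p \<oplus> u) p}"

definition lin_at :: "('v, 'e) gbs \<Rightarrow> 'v pt \<Rightarrow> avec set" where
  "lin_at G p = {w - w' | w w'. w \<in> Aplus G \<and> w' \<in> Aplus G \<and>
     conj G (p \<oplus> w) (p \<oplus> w') \<and> conj G (p \<oplus> w') p}"

text \<open>
  If \<open>p + a\<close> is conjugate to \<open>q\<close>, translating a relation at \<open>p\<close> by \<open>a\<close> gives the same relation at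
  \<open>q\<close>. This applies to the supports here and to the linear parts below; on a quasi-conjugacy class
  it works in both directions.
\<close>

lemma supp_at_mono:
  assumes "gbs_graph G" "conj_le G p q"
  shows "supp_at G p \<subseteq> supp_at G q"
proof -
  from assms obtain a where a: "a \<in> Aplus G" "conj G (p \<oplus> a) q"
    by (auto simp: conj_le_iff)
  have "qconj G (q \<oplus> u) q" if u: "u \<in> Aplus G" "qconj G (p \<oplus> u) p" for u
  proof -
    have "qconj G (p \<oplus> a \<oplus> u) (p \<oplus> a)"
      using u a assms(1) conj_le_translate[OF assms(1) a(1), of "p \<oplus> u" p]
        conj_le_translate[OF assms(1) a(1), of p "p \<oplus> u"]
      by (simp add: qconj_def add.commute)
    moreover have "qconj G (q \<oplus> u) (p \<oplus> a \<oplus> u)"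
      using a u assms(1) by (intro conj_imp_qconj conj_sym[OF _ conj_translate]) auto
    ultimately show ?thesis
      using a assms(1) by (meson conj_imp_qconj qconj_trans)
  qed
  then show ?thesis unfolding supp_at_def by blast
qed

lemma lin_at_mono:
  assumes "gbs_graph G" "conj_le G p q"
  shows "lin_at G p \<subseteq> lin_at G q"
proof -
  from assms obtain a where a: "a \<in> Aplus G" "conj G (p \<oplus> a) q"
    by (auto simp: conj_le_iff)
  have shift: "conj G (q \<oplus> w) (q \<oplus> w')"
    if w: "w \<in> Aplus G" "w' \<in> Aplus G" "conj G (p \<oplus> w) (p \<oplus> w')" for w w'
  proof -
    have "conj G (p \<oplus> a \<oplus> w) (p \<oplus> a \<oplus> w')"
      using conj_translate[OF assms(1) a(1) w(3)] by (simp add: add.commute)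
    moreover have "conj G (p \<oplus> a \<oplus> w) (q \<oplus> w)" "conj G (p \<oplus> a \<oplus> w') (q \<oplus> w')"
      using a w assms(1) by (intro conj_translate; simp)+
    ultimately show ?thesis
      using assms(1) by (meson conj_sym conj_trans)
  qed
  show ?thesis
  proof
    fix x assume "x \<in> lin_at G p"
    then obtain w w' where x: "x = w - w'" "w \<in> Aplus G" "w' \<in> Aplus G"
      and "conj G (p \<oplus> w) (p \<oplus> w')" "conj G (p \<oplus> w') p"
      unfolding lin_at_def by blast
    then have "conj G (q \<oplus> w) (q \<oplus> w')" "conj G (q \<oplus> w') q"
      using shift[of w w'] shift[of w' 0] by simp_all
    with x show "x \<in> lin_at G q" unfolding lin_at_def by blast
  qed
qed

lemma
  assumes "gbs_graph G" "Q \<in> qc_classes G" "p \<in> Q"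
  shows supp_qc_eq: "supp_qc G Q = supp_at G p"
    and lin_qc_eq: "lin_qc G Q = lin_at G p"
proof -
  have "(SOME p. p \<in> Q) \<in> Q" using assms(3) by (rule someI)
  then have "qconj G (SOME p. p \<in> Q) p" using qc_class_qconj assms by blast
  then have le: "conj_le G (SOME p. p \<in> Q) p" "conj_le G p (SOME p. p \<in> Q)"
    by (auto simp: qconj_def)
  show "supp_qc G Q = supp_at G p"
    using le[THEN supp_at_mono[OF assms(1)]] unfolding supp_qc_def Let_def supp_at_def by blast
  show "lin_qc G Q = lin_at G p"
    using le[THEN lin_at_mono[OF assms(1)]] unfolding lin_qc_def Let_def lin_at_def by blast
qed

section \<open>Correspondences that preserve conjugacy\<close>

text \<open>
  The edge map is required to preserve the conjugacy class of an initial vertex, but not the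
  vertex itself: edge counts see no more than the class, and a slide already moves an endpoint
  within its class.
\<close>

definition conj_preserving ::
    "('v \<Rightarrow> 'w) \<Rightarrow> ('e \<Rightarrow> 'f) \<Rightarrow> ('v, 'e) gbs \<Rightarrow> ('w, 'f) gbs \<Rightarrow> bool" where
  "conj_preserving \<phi> \<sigma> G G' \<longleftrightarrow>
     gbs_primes G' = gbs_primes G \<and>
     bij_betw \<phi> (verts G) (verts G') \<and> bij_betw \<sigma> (edges G) (edges G') \<and>
     (\<forall>p\<in>aff_verts G. \<forall>q\<in>aff_verts G. conj G' (map_pt \<phi> p) (map_pt \<phi> q) \<longleftrightarrow> conj G p q) \<and>
     (\<forall>x\<in>edges G. conj G' (map_pt \<phi> (aff_init G x)) (aff_init G' (\<sigma> x)))"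

lemma map_pt_translate [simp]: "map_pt \<phi> (p \<oplus> w) = map_pt \<phi> p \<oplus> w"
  by (simp add: map_pt_def translate_def map_prod_def case_prod_unfold)

lemma map_pt_id [simp]: "map_pt id = id"
  by (simp add: map_pt_def map_prod.id)

lemma map_pt_comp: "map_pt (\<psi> \<circ> \<phi>) p = map_pt \<psi> (map_pt \<phi> p)"
  by (simp add: map_pt_def map_prod_def case_prod_unfold)

lemma Aplus_cong: "gbs_primes G' = gbs_primes G \<Longrightarrow> Aplus G' = Aplus G"
  by (simp add: Aplus_def)

lemma bij_betw_map_pt:
  assumes "gbs_primes G' = gbs_primes G" "bij_betw \<phi> (verts G) (verts G')"
  shows "bij_betw (map_pt \<phi>) (aff_verts G) (aff_verts G')"
  using bij_betw_map_prod[OF assms(2) bij_betw_id[of "Aplus G"]] Aplus_cong[OF assms(1)]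
  by (simp add: aff_verts_def map_pt_def)

lemma conj_preserving_refl:
  assumes "gbs_graph G"
  shows "conj_preserving id id G G"
  using assms by (auto simp: conj_preserving_def conj_refl)

lemma conj_preserving_trans:
  assumes "gbs_graph G" "gbs_graph G''"
    and 1: "conj_preserving \<phi> \<sigma> G G'" and 2: "conj_preserving \<psi> \<rho> G' G''"
  shows "conj_preserving (\<psi> \<circ> \<phi>) (\<rho> \<circ> \<sigma>) G G''"
proof -
  have m: "map_pt \<phi> p \<in> aff_verts G'" if "p \<in> aff_verts G" for p
    using bij_betw_map_pt[of G' G \<phi>] 1 that by (auto simp: conj_preserving_def bij_betw_def)
  have "conj G'' (map_pt (\<psi> \<circ> \<phi>) (aff_init G x)) (aff_init G'' ((\<rho> \<circ> \<sigma>) x))"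
    if x: "x \<in> edges G" for x
  proof -
    have "\<sigma> x \<in> edges G'" using 1 x by (auto simp: conj_preserving_def bij_betw_def)
    then have "conj G'' (map_pt \<psi> (aff_init G' (\<sigma> x))) (aff_init G'' (\<rho> (\<sigma> x)))"
      using 2 by (simp add: conj_preserving_def)
    moreover have link: "conj G' (map_pt \<phi> (aff_init G x)) (aff_init G' (\<sigma> x))"
      using 1 x by (simp add: conj_preserving_def)
    have "conj G'' (map_pt \<psi> (map_pt \<phi> (aff_init G x))) (map_pt \<psi> (aff_init G' (\<sigma> x)))"
      using 2 link conj_verts[OF link] by (simp add: conj_preserving_def)
    ultimately show ?thesis
      using conj_trans[OF assms(2)] by (simp add: map_pt_comp)
  qed
  moreover have "bij_betw (\<psi> \<circ> \<phi>) (verts G) (verts G'')" "bij_betw (\<rho> \<circ> \<sigma>) (edges G) (edges G'')"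
    using 1 2 unfolding conj_preserving_def by (blast intro: bij_betw_trans)+
  ultimately show ?thesis
    using 1 2 m by (simp add: conj_preserving_def map_pt_comp)
qed

lemma bij_betw_quotient:
  assumes m: "bij_betw m A B" and r: "r \<subseteq> A \<times> A" and s: "s \<subseteq> B \<times> B"
    and rs: "\<And>x y. x \<in> A \<Longrightarrow> y \<in> A \<Longrightarrow> (m x, m y) \<in> s \<longleftrightarrow> (x, y) \<in> r"
  shows "B // s = (`) m ` (A // r)"
proof -
  have "s `` {m x} = m ` (r `` {x})" if "x \<in> A" for x
  proof (intro equalityI subsetI)
    fix z assume "z \<in> s `` {m x}"
    moreover then obtain y where "y \<in> A" "z = m y"
      using s m by (auto simp: bij_betw_def)
    ultimately show "z \<in> m ` (r `` {x})" using rs that by auto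
  qed (use rs r that in auto)
  then have "(\<lambda>y. s `` {y}) ` (m ` A) = (`) m ` ((\<lambda>x. r `` {x}) ` A)"
    by (force simp: image_image)
  moreover have "B = m ` A" using m by (simp add: bij_betw_def)
  ultimately show ?thesis
    by (simp add: quotient_def UNION_singleton_eq_range)
qed

context
  fixes G :: "('v, 'e) gbs" and G' :: "('w, 'f) gbs" and \<phi> :: "'v \<Rightarrow> 'w" and \<sigma> :: "'e \<Rightarrow> 'f"
  assumes G: "gbs_graph G" and G': "gbs_graph G'" and pres: "conj_preserving \<phi> \<sigma> G G'"
begin

lemma preserved_Aplus: "Aplus G' = Aplus G"
  using pres by (intro Aplus_cong) (simp add: conj_preserving_def)

lemma preserved_verts: "bij_betw (map_pt \<phi>) (aff_verts G) (aff_verts G')"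
  using pres by (simp add: conj_preserving_def bij_betw_map_pt)

lemma map_pt_in: "p \<in> aff_verts G \<Longrightarrow> map_pt \<phi> p \<in> aff_verts G'"
  by (rule bij_betw_apply[OF preserved_verts])

lemma map_pt_eq_iff:
  "p \<in> aff_verts G \<Longrightarrow> q \<in> aff_verts G \<Longrightarrow> map_pt \<phi> p = map_pt \<phi> q \<longleftrightarrow> p = q"
  by (rule inj_on_eq_iff[OF bij_betw_imp_inj_on[OF preserved_verts]])

lemma preserved_conj:
  "p \<in> aff_verts G \<Longrightarrow> q \<in> aff_verts G \<Longrightarrow> conj G' (map_pt \<phi> p) (map_pt \<phi> q) \<longleftrightarrow> conj G p q"
  using pres by (simp add: conj_preserving_def)

lemma preserved_pt_le:
  assumes "p \<in> aff_verts G" "q \<in> aff_verts G"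
  shows "pt_le G' (map_pt \<phi> p) (map_pt \<phi> q) \<longleftrightarrow> pt_le G p q"
proof -
  have "map_pt \<phi> q = map_pt \<phi> p \<oplus> w \<longleftrightarrow> q = p \<oplus> w" if "w \<in> Aplus G" for w
    using map_pt_eq_iff[of q "p \<oplus> w"] assms that by simp
  then show ?thesis by (auto simp: pt_le_def preserved_Aplus)
qed

lemma preserved_conj_le:
  assumes "p \<in> aff_verts G" "q \<in> aff_verts G"
  shows "conj_le G' (map_pt \<phi> p) (map_pt \<phi> q) \<longleftrightarrow> conj_le G p q"
proof -
  have "conj G' (map_pt \<phi> p \<oplus> w) (map_pt \<phi> q) \<longleftrightarrow> conj G (p \<oplus> w) q" if "w \<in> Aplus G" for w
    using preserved_conj[of "p \<oplus> w" q] assms that by simp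
  then show ?thesis using assms by (auto simp: conj_le_iff preserved_Aplus map_pt_in)
qed

lemma preserved_qconj:
  "p \<in> aff_verts G \<Longrightarrow> q \<in> aff_verts G \<Longrightarrow>
    qconj G' (map_pt \<phi> p) (map_pt \<phi> q) \<longleftrightarrow> qconj G p q"
  by (simp add: qconj_def preserved_conj_le)

lemma preserved_qc_classes: "qc_classes G' = (`) (map_pt \<phi>) ` qc_classes G"
  unfolding qc_classes_def
  by (rule bij_betw_quotient[OF preserved_verts])
     (auto simp: preserved_qconj dest: qconj_verts)

lemma preserved_conj_classes: "conj_classes G' = (`) (map_pt \<phi>) ` conj_classes G"
  unfolding conj_classes_def
  by (rule bij_betw_quotient[OF preserved_verts])
     (auto simp: preserved_conj dest: conj_verts)

lemma preserved_min_qc: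
  assumes "Q \<subseteq> aff_verts G"
  shows "min_qc G' (map_pt \<phi> ` Q) = map_pt \<phi> ` min_qc G Q"
proof -
  have le: "pt_le G' (map_pt \<phi> p) (map_pt \<phi> q) \<longleftrightarrow> pt_le G p q" if "p \<in> Q" "q \<in> Q" for p q
    using preserved_pt_le assms that by blast
  have "min_qc G' (map_pt \<phi> ` Q) = map_pt \<phi> `
      {q \<in> Q. \<forall>q'\<in>Q. pt_le G' (map_pt \<phi> q') (map_pt \<phi> q) \<longrightarrow> pt_le G' (map_pt \<phi> q) (map_pt \<phi> q')}"
    unfolding min_qc_def by blast
  also have "{q \<in> Q. \<forall>q'\<in>Q. pt_le G' (map_pt \<phi> q') (map_pt \<phi> q) \<longrightarrow>
      pt_le G' (map_pt \<phi> q) (map_pt \<phi> q')} = min_qc G Q"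
    unfolding min_qc_def using le by blast
  finally show ?thesis .
qed

text \<open>
  The point selected in the image of \<open>Q\<close> need not be the image of the point selected in \<open>Q\<close>, so
  both sides are compared at a common point.
\<close>

lemma preserved_supp_qc_lin_qc:
  assumes "Q \<in> qc_classes G"
  shows "supp_qc G' (map_pt \<phi> ` Q) = supp_qc G Q" "lin_qc G' (map_pt \<phi> ` Q) = lin_qc G Q"
proof -
  obtain p where p: "p \<in> Q" "p \<in> aff_verts G"
    using assms qc_class_subset[OF G assms] in_quotient_imp_non_empty[OF equiv_qconj[OF G]]
    unfolding qc_classes_def by blast
  have Q': "map_pt \<phi> ` Q \<in> qc_classes G'"
    using assms by (simp add: preserved_qc_classes)
  have "qconj G' (map_pt \<phi> p \<oplus> u) (map_pt \<phi> p) \<longleftrightarrow> qconj G (p \<oplus> u) p" if "u \<in> Aplus G" for u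
    using preserved_qconj[of "p \<oplus> u" p] p that by simp
  then have "supp_at G' (map_pt \<phi> p) = supp_at G p"
    unfolding supp_at_def preserved_Aplus by blast
  then show "supp_qc G' (map_pt \<phi> ` Q) = supp_qc G Q"
    using supp_qc_eq[OF G assms p(1)] supp_qc_eq[OF G' Q' imageI[OF p(1)]] by simp
  have "conj G' (map_pt \<phi> p \<oplus> u) (map_pt \<phi> p \<oplus> v) \<longleftrightarrow> conj G (p \<oplus> u) (p \<oplus> v)"
    "conj G' (map_pt \<phi> p \<oplus> v) (map_pt \<phi> p) \<longleftrightarrow> conj G (p \<oplus> v) p"
    if "u \<in> Aplus G" "v \<in> Aplus G" for u v
    using preserved_conj[of "p \<oplus> u" "p \<oplus> v"] preserved_conj[of "p \<oplus> v" p] p that by simp_all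
  then have "lin_at G' (map_pt \<phi> p) = lin_at G p"
    unfolding lin_at_def preserved_Aplus by blast
  then show "lin_qc G' (map_pt \<phi> ` Q) = lin_qc G Q"
    using lin_qc_eq[OF G assms p(1)] lin_qc_eq[OF G' Q' imageI[OF p(1)]] by simp
qed

text \<open>
  Only unions of conjugacy classes are covered, since \<open>\<sigma>\<close> may change the initial vertex
  of an edge within its conjugacy class. Conjugacy classes and quasi-conjugacy classes are such
  unions.
\<close>

lemma preserved_edges_in:
  assumes "X \<subseteq> aff_verts G" and closed: "\<And>p q. p \<in> X \<Longrightarrow> conj G p q \<Longrightarrow> q \<in> X"
  shows "bij_betw \<sigma> (edges_in G X) (edges_in G' (map_pt \<phi> ` X))"
proof -
  have \<sigma>: "bij_betw \<sigma> (edges G) (edges G')"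
    using pres by (simp add: conj_preserving_def)
  have iff: "aff_init G' (\<sigma> x) \<in> map_pt \<phi> ` X \<longleftrightarrow> aff_init G x \<in> X" if x: "x \<in> edges G" for x
  proof -
    have "\<sigma> x \<in> edges G'" using \<sigma> x by (auto simp: bij_betw_def)
    then obtain y where y: "y \<in> aff_verts G" "aff_init G' (\<sigma> x) = map_pt \<phi> y"
      using preserved_verts G' aff_init_in by (metis bij_betw_imp_surj_on imageE)
    have "conj G' (map_pt \<phi> (aff_init G x)) (aff_init G' (\<sigma> x))"
      using pres x by (simp add: conj_preserving_def)
    then have xy: "conj G (aff_init G x) y"
      using y x G preserved_conj by simp
    have "map_pt \<phi> y \<in> map_pt \<phi> ` X \<longleftrightarrow> y \<in> X"
      by (rule inj_on_image_mem_iff[OF bij_betw_imp_inj_on[OF preserved_verts] y(1) assms(1)])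
    also have "\<dots> \<longleftrightarrow> aff_init G x \<in> X"
      using closed xy conj_sym[OF G xy] by blast
    finally show ?thesis using y by simp
  qed
  have surj: "edges G' = \<sigma> ` edges G" using \<sigma> by (simp add: bij_betw_def)
  have "\<sigma> ` edges_in G X = edges_in G' (map_pt \<phi> ` X)"
    unfolding edges_in_def surj Compr_image_eq
    by (intro arg_cong[of _ _ "(`) \<sigma>"] Collect_cong conj_cong refl iff[symmetric]) simp_all
  moreover have "edges_in G X \<subseteq> edges G" unfolding edges_in_def by blast
  ultimately show ?thesis
    by (intro bij_betw_subset[OF \<sigma>])
qed

lemma preserved_edge_count:
  assumes "X \<in> qc_classes G \<union> conj_classes G"
  shows "card (edges_in G' (map_pt \<phi> ` X)) = card (edges_in G X)"
    and "edges_in G' (map_pt \<phi> ` X) = {} \<longleftrightarrow> edges_in G X = {}"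
proof -
  have "X \<subseteq> aff_verts G"
    using assms qc_class_subset[OF G] conj_class_subset[OF G] by blast
  moreover have "q \<in> X" if "p \<in> X" "conj G p q" for p q
    using assms that qc_class_conj_closed[OF G] conj_class_conj_closed[OF G] by blast
  ultimately have bij: "bij_betw \<sigma> (edges_in G X) (edges_in G' (map_pt \<phi> ` X))"
    by (rule preserved_edges_in)
  show "card (edges_in G' (map_pt \<phi> ` X)) = card (edges_in G X)"
    using bij_betw_same_card[OF bij] by simp
  show "edges_in G' (map_pt \<phi> ` X) = {} \<longleftrightarrow> edges_in G X = {}"
    unfolding bij_betw_imp_surj_on[OF bij, symmetric] by simp
qed

lemma preserved_linear_invariants:
  "linear_invariants G' = map_lin_inv \<phi> (linear_invariants G)"
proof -
  let ?m = "(`) (map_pt \<phi>)"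
  have "(\<lambda>Q. (Q, min_qc G' Q, supp_qc G' Q, lin_qc G' Q, card (edges_in G' Q))) `
          {Q \<in> ?m ` qc_classes G. edges_in G' Q \<noteq> {}} =
        (\<lambda>Q. (?m Q, ?m (min_qc G Q), supp_qc G Q, lin_qc G Q, card (edges_in G Q))) `
          {Q \<in> qc_classes G. edges_in G Q \<noteq> {}}"
  proof -
    have img: "{Q \<in> ?m ` qc_classes G. edges_in G' Q \<noteq> {}} =
        ?m ` {Q \<in> qc_classes G. edges_in G Q \<noteq> {}}"
      unfolding Compr_image_eq
      by (intro arg_cong[of _ _ "(`) ?m"] Collect_cong conj_cong refl)
        (simp add: preserved_edge_count(2))
    have inv: "(?m Q, min_qc G' (?m Q), supp_qc G' (?m Q), lin_qc G' (?m Q),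
          card (edges_in G' (?m Q))) =
        (?m Q, ?m (min_qc G Q), supp_qc G Q, lin_qc G Q, card (edges_in G Q))"
      if "Q \<in> qc_classes G" for Q
      using that qc_class_subset[OF G that]
      by (simp add: preserved_min_qc preserved_supp_qc_lin_qc preserved_edge_count(1))
    show ?thesis
      unfolding img image_image by (rule image_cong[OF refl], rule inv) simp
  qed
  moreover have "(\<lambda>C. (C, card (edges_in G' C))) `
        {C \<in> ?m ` conj_classes G. edges_in G' C \<noteq> {}} =
      (\<lambda>C. (?m C, card (edges_in G C))) ` {C \<in> conj_classes G. edges_in G C \<noteq> {}}"
  proof -
    have img: "{C \<in> ?m ` conj_classes G. edges_in G' C \<noteq> {}} =
        ?m ` {C \<in> conj_classes G. edges_in G C \<noteq> {}}"
      unfolding Compr_image_eq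
      by (intro arg_cong[of _ _ "(`) ?m"] Collect_cong conj_cong refl)
        (simp add: preserved_edge_count(2))
    show ?thesis
      unfolding img image_image
      by (rule image_cong[OF refl]) (simp add: preserved_edge_count(1))
  qed
  ultimately show ?thesis
    using pres
    by (simp add: linear_invariants_def map_lin_inv_def setcompr_eq_image image_image
        preserved_qc_classes preserved_conj_classes conj_preserving_def)
qed

end

section \<open>Moves preserve conjugacy\<close>

context
  fixes G G' :: "('v, 'e) gbs" and D :: "'e set"
  assumes G: "gbs_graph G" and G': "gbs_graph G'"
    and D: "D \<subseteq> edges G" and unchanged: "unchanged_outside D G G'"
begin

lemma unchanged_simps:
  "verts G' = verts G" "edges G' = edges G" "x \<in> edges G \<Longrightarrow> opp G' x = opp G x"
  using unchanged by (auto simp: unchanged_outside_def)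

lemma unchanged_ends:
  assumes "x \<in> edges G" "x \<notin> D" "x \<notin> opp G ` D"
  shows "aff_term G' x = aff_term G x" "aff_init G' x = aff_init G x"
proof -
  have x: "opp G (opp G x) = x" using assms(1) G by (simp add: opp_opp)
  have "opp G x \<notin> D" using assms(3) x by force
  moreover have "opp G x \<notin> opp G ` D"
  proof
    assume "opp G x \<in> opp G ` D"
    then obtain y where "y \<in> D" "opp G x = opp G y" by blast
    then have "x = y" using D x opp_opp[OF G, of y] by auto
    with \<open>y \<in> D\<close> assms(2) show False by simp
  qed
  ultimately have "aff_term G' (opp G x) = aff_term G (opp G x)"
    using unchanged opp_edges[OF G assms(1)] unfolding unchanged_outside_def by blast
  then show "aff_init G' x = aff_init G x"
    using assms unfolding aff_init_def by (simp add: unchanged_simps del: aff_term_opp)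
  show "aff_term G' x = aff_term G x"
    using assms unchanged by (auto simp: unchanged_outside_def)
qed

lemma unchanged_joins:
  "joins G e p q \<Longrightarrow> e \<notin> D \<Longrightarrow> e \<notin> opp G ` D \<Longrightarrow> joins G' e p q"
  by (simp add: joins_def unchanged_simps unchanged_ends)

lemma unchanged_outside_sym: "unchanged_outside D G' G"
  using unchanged D unchanged_simps(3) by (auto simp: unchanged_outside_def image_iff subset_iff)

text \<open>
  For the primes, and below for conjugacy, one inclusion between \<open>G\<close> and \<open>G'\<close> depends only on
  the edges in \<open>D\<close>. Since \<open>unchanged_outside\<close> is symmetric, the other inclusion follows from
  the same facts with the graphs interchanged.
\<close>

lemma gbs_primes_subset_if_ends:
  assumes "\<And>x. x \<in> D \<Longrightarrow> supp (snd (aff_init G x)) \<subseteq> gbs_primes G'"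
    and "\<And>x. x \<in> D \<Longrightarrow> supp (snd (aff_term G x)) \<subseteq> gbs_primes G'"
  shows "gbs_primes G \<subseteq> gbs_primes G'"
proof -
  have "supp (snd (aff_term G x)) \<subseteq> gbs_primes G'" if x: "x \<in> edges G" for x
  proof (cases "x \<in> D \<union> opp G ` D")
    case True
    then show ?thesis using assms by (elim UnE imageE) (simp_all only: aff_term_opp)
  next
    case False
    then have "aff_term G x \<in> aff_verts G'"
      using x G' unchanged_ends(1)[of x] aff_term_in[of G' x] by (simp add: unchanged_simps)
    then show ?thesis by (rule supp_subset_primes)
  qed
  then show ?thesis by (auto simp: gbs_primes_eq_supp[OF G])
qed

text \<open>
  Each translate of an edge of \<open>G\<close> can be replaced by the translate of an affine path of \<open>G'\<close>
  between the same endpoints.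
\<close>

lemma conj_imp_conj_if_ends:
  assumes primes: "gbs_primes G' = gbs_primes G"
    and ends: "\<And>x. x \<in> D \<Longrightarrow> conj G' (aff_init G x) (aff_term G x)"
    and "conj G p q"
  shows "conj G' p q"
proof -
  have edge: "conj G' (aff_init G x) (aff_term G x)" if x: "x \<in> edges G" for x
  proof -
    consider "x \<in> D" | y where "y \<in> D" "x = opp G y" | "x \<notin> D" "x \<notin> opp G ` D"
      by auto
    then show ?thesis
    proof cases
      case 2
      then have "conj G' (aff_term G y) (aff_init G y)" using ends G' by (auto intro: conj_sym)
      with 2 D G show ?thesis by auto
    next
      case 3
      then show ?thesis
        using x G' conj_joins[of G' x] unchanged_ends by (auto simp: joins_def unchanged_simps)
    qed (use ends in auto)
  qed
  have step: "conj G' u v" if "aff_step G u v" for u v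
    using that edge conj_translate[OF G'] Aplus_cong[OF primes] unfolding aff_step_def by metis
  have "(aff_step G)\<^sup>*\<^sup>* p q" "p \<in> aff_verts G"
    using assms(3) G by (auto simp: conj_iff_aff_steps)
  moreover have "aff_verts G' = aff_verts G"
    by (simp add: aff_verts_def unchanged_simps Aplus_cong[OF primes])
  ultimately show ?thesis
    by induction (auto intro: conj_refl conj_trans[OF G'] step)
qed

end

lemma supp_translate:
  "p \<in> aff_verts G \<Longrightarrow> a \<in> Aplus G \<Longrightarrow> supp (snd (p \<oplus> a)) = supp (snd p) \<union> supp a"
  by (cases p) (auto simp: aff_verts_def translate_def supp_add)

lemma supp_joins:
  assumes "gbs_graph G" "joins G e p q"
  shows "supp (snd p) \<subseteq> gbs_primes G" "supp (snd q) \<subseteq> gbs_primes G"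
  using joins_verts[OF assms] supp_subset_primes by blast+

lemma distinct_edgesD:
  assumes "gbs_graph G" "e \<in> edges G" "f \<in> edges G" "distinct_edges G e f"
  shows "e \<noteq> f" "e \<noteq> opp G f" "f \<noteq> opp G e"
  using assms by (auto simp: distinct_edges_def opp_opp)

lemma joins_edge: "joins G e p q \<Longrightarrow> e \<in> edges G"
  by (simp add: joins_def)

text \<open>
  A slide is undone by sliding back along the reverse of the same edge. The primes come first,
  here and for the other moves, since the conditions of a move refer to \<open>Aplus\<close>. They are
  unchanged because \<open>p\<close>, \<open>q\<close>, \<open>r\<close> and the translation vector occur in the endpoints both before and
  after the move.
\<close>

lemma slide_move_sym:
  assumes G: "gbs_graph G" and G': "gbs_graph G'" and "slide_move G G'"
  shows "gbs_primes G' = gbs_primes G" "slide_move G' G"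
proof -
  from assms(3) obtain e f p q r a where a: "a \<in> Aplus G"
    and dist: "distinct_edges G e f" and unch: "unchanged_outside {f} G G'"
    and e: "joins G e p q" and f: "joins G f r (p \<oplus> a)" and f': "joins G' f r (q \<oplus> a)"
    unfolding slide_move_def by blast
  note D = joins_edge[OF f]
  have unch': "unchanged_outside {f} G' G"
    using unchanged_outside_sym[OF G G' _ unch] D by simp
  have e': "joins G' e p q"
    using unchanged_joins[OF G G' _ unch e] D
      distinct_edgesD[OF G joins_edge[OF e] joins_edge[OF f] dist]
    by simp
  note V = joins_verts[OF G e] joins_verts[OF G f]
  show P: "gbs_primes G' = gbs_primes G"
  proof
    show "gbs_primes G' \<subseteq> gbs_primes G"
      using f' D a V
      by (intro gbs_primes_subset_if_ends[OF G' G _ unch'] supp_subset_primes)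
         (auto simp: joins_def)
    show "gbs_primes G \<subseteq> gbs_primes G'"
      using f D a V supp_joins[OF G' f'] supp_joins[OF G' e']
      by (intro gbs_primes_subset_if_ends[OF G G' _ unch])
         (auto simp: joins_def supp_translate[where G = G])
  qed
  have "joins G' (opp G' e) q p"
    using e' G' by (auto simp: joins_def opp_edges)
  moreover have "distinct_edges G' (opp G' e) f"
  proof -
    have "opp G' e = opp G e"
      using unchanged_simps(3)[OF G G' _ unch joins_edge[OF e]] D by simp
    moreover have "opp G' (opp G' e) = e"
      by (rule opp_opp[OF G' joins_edge[OF e']])
    ultimately show ?thesis
      using distinct_edgesD[OF G joins_edge[OF e] joins_edge[OF f] dist]
      unfolding distinct_edges_def by metis
  qed
  ultimately show "slide_move G' G"
    unfolding slide_move_def using unch' f f' a Aplus_cong[OF P] by blast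
qed

lemma slide_move_conj:
  assumes G: "gbs_graph G" and G': "gbs_graph G'" and move: "slide_move G G'"
    and "conj G x y"
  shows "conj G' x y"
proof -
  from move obtain e f p q r a where a: "a \<in> Aplus G"
    and dist: "distinct_edges G e f" and unch: "unchanged_outside {f} G G'"
    and e: "joins G e p q" and f: "joins G f r (p \<oplus> a)" and f': "joins G' f r (q \<oplus> a)"
    unfolding slide_move_def by blast
  note P = slide_move_sym(1)[OF G G' move]
  have "joins G' e p q"
    using unchanged_joins[OF G G' _ unch e] joins_edge[OF f]
      distinct_edgesD[OF G joins_edge[OF e] joins_edge[OF f] dist] by simp
  then have "conj G' (p \<oplus> a) (q \<oplus> a)"
    using G' a Aplus_cong[OF P] by (intro conj_translate conj_joins) auto
  moreover have "conj G' r (q \<oplus> a)" using conj_joins[OF G' f'] .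
  ultimately have "conj G' r (p \<oplus> a)" using G' by (meson conj_sym conj_trans)
  then show ?thesis
    using f by (intro conj_imp_conj_if_ends[OF G G' _ unch P _ assms(4)]) (auto simp: joins_def)
qed

text \<open>
  A swap is undone by the swap in which the two edges change roles, because the conditions on
  \<open>(w1, k1)\<close> and \<open>(w2, k2)\<close> are the same.
\<close>

lemma swap_move_sym:
  assumes G: "gbs_graph G" and G': "gbs_graph G'" and "swap_move G G'"
  shows "gbs_primes G' = gbs_primes G" "swap_move G' G"
proof -
  from assms(3) obtain e f p q k1 k2 w1 w2 where w: "w1 \<in> Aplus G" "w2 \<in> Aplus G"
    and dist: "distinct_edges G e f" and unch: "unchanged_outside {e, f} G G'"
    and e: "joins G e p (p \<oplus> w1)" and f: "joins G f q (q \<oplus> w2)"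
    and le: "pt_le G p q" "pt_le G q (p \<oplus> scale k1 w1)" "pt_le G q (p \<oplus> scale k2 w2)"
    and e': "joins G' e q (q \<oplus> w1)" and f': "joins G' f p (p \<oplus> w2)"
    unfolding swap_move_def by blast
  have D: "{e, f} \<subseteq> edges G" using e f by (simp add: joins_def)
  \<comment> \<open>In the inverse swap \<open>f\<close> is the first edge and \<open>e\<close> the second.\<close>
  have unch': "unchanged_outside {f, e} G' G"
    using unchanged_outside_sym[OF G G' D unch] by (simp add: insert_commute)
  note V = joins_verts[OF G e] joins_verts[OF G f]
  show P: "gbs_primes G' = gbs_primes G"
  proof
    show "gbs_primes G' \<subseteq> gbs_primes G"
      using e' f' w V
      by (intro gbs_primes_subset_if_ends[OF G' G _ unch'] supp_subset_primes)
         (auto simp: joins_def)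
    show "gbs_primes G \<subseteq> gbs_primes G'"
      using e f w V supp_joins[OF G' e'] supp_joins[OF G' f']
      by (intro gbs_primes_subset_if_ends[OF G G' D unch])
         (auto simp: joins_def supp_translate[where G = G])
  qed
  have "distinct_edges G' f e"
    using distinct_edgesD[OF G joins_edge[OF e] joins_edge[OF f] dist]
      unchanged_simps(3)[OF G G' D unch] D
    by (auto simp: distinct_edges_def)
  moreover have "pt_le G' = pt_le G"
    by (simp add: pt_le_def Aplus_cong[OF P] fun_eq_iff)
  ultimately show "swap_move G' G"
    unfolding swap_move_def using unch' e f e' f' w le Aplus_cong[OF P] by metis
qed

text \<open>
  The new loop with vector \<open>w1\<close> is only available above \<open>q\<close>. The other new loop carries \<open>p\<close> to such
  a point, and it can be undone after \<open>w1\<close> has been added.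
\<close>

lemma swap_move_conj:
  assumes G: "gbs_graph G" and G': "gbs_graph G'" and move: "swap_move G G'"
    and "conj G x y"
  shows "conj G' x y"
proof -
  from move obtain e f p q k w1 w2 a b where w: "w1 \<in> Aplus G" "w2 \<in> Aplus G"
    and unch: "unchanged_outside {e, f} G G'"
    and e: "joins G e p (p \<oplus> w1)" and f: "joins G f q (q \<oplus> w2)"
    and a: "a \<in> Aplus G" "q = p \<oplus> a" and b: "b \<in> Aplus G" "p \<oplus> scale k w2 = q \<oplus> b"
    and e': "joins G' e q (q \<oplus> w1)" and f': "joins G' f p (p \<oplus> w2)"
    unfolding swap_move_def pt_le_def by blast
  note P = swap_move_sym(1)[OF G G' move]
  have A: "Aplus G = Aplus G'" using Aplus_cong[OF P] by simp
  note w = w[unfolded A] and a = a[unfolded A] and b = b[unfolded A]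
  note [trans] = conj_trans[OF G']
  have loop: "conj G' p (p \<oplus> w2)" using conj_joins[OF G' f'] .
  then have up: "conj G' p (q \<oplus> b)" using conj_scale[OF G' w(2)] b(2) by metis
  note up
  also have "conj G' (q \<oplus> b) (q \<oplus> w1 \<oplus> b)"
    by (intro conj_translate conj_joins[OF G' e'] G' b)
  also have "q \<oplus> w1 \<oplus> b = q \<oplus> b \<oplus> w1" by (simp add: add.commute)
  also have "conj G' (q \<oplus> b \<oplus> w1) (p \<oplus> w1)"
    by (intro conj_translate conj_sym[OF G' up] G' w)
  finally have ends_e: "conj G' p (p \<oplus> w1)" .
  have ends_f: "conj G' q (q \<oplus> w2)"
    using conj_translate[OF G' a(1) loop] a(2) by (simp add: add.commute)
  show ?thesis
    using e f ends_e ends_f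
    by (intro conj_imp_conj_if_ends[OF G G' _ unch P _ assms(4)]) (auto simp: joins_def)
qed

text \<open>
  A connection is undone by the connection in which \<open>p\<close> and \<open>q\<close>, and \<open>w1\<close> and \<open>w2\<close>, change places.
  The equation \<open>w1 + w2 = k w\<close> shows that a prime that occurs in \<open>w1\<close> occurs in \<open>w\<close>, so it is not
  lost when the edge that contains \<open>w1\<close> is replaced.
\<close>

lemma connection_move_sym:
  assumes G: "gbs_graph G" and G': "gbs_graph G'" and "connection_move G G'"
  shows "gbs_primes G' = gbs_primes G" "connection_move G' G"
proof -
  from assms(3) obtain e f p q k w w1 w2
    where w: "w \<in> Aplus G" "w1 \<in> Aplus G" "w2 \<in> Aplus G"
    and dist: "distinct_edges G e f" and unch: "unchanged_outside {e, f} G G'"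
    and e: "joins G e q (p \<oplus> w1)" and f: "joins G f p (p \<oplus> w)"
    and k: "w1 + w2 = scale k w"
    and e': "joins G' e p (q \<oplus> w2)" and f': "joins G' f q (q \<oplus> w)"
    unfolding connection_move_def by blast
  have D: "{e, f} \<subseteq> edges G" using e f by (simp add: joins_def)
  have unch': "unchanged_outside {e, f} G' G"
    using unchanged_outside_sym[OF G G' D unch] .
  note V = joins_verts[OF G e] joins_verts[OF G f]
  \<comment> \<open>There is no cancellation in \<open>w1 + w2\<close>, so the support of \<open>w1\<close> is part of that of \<open>k w\<close>.\<close>
  have supp_w: "supp w1 \<subseteq> supp w"
    using supp_add[OF w(2,3)] supp_scale_subset[OF w(1), of k] k by auto
  show P: "gbs_primes G' = gbs_primes G"
  proof
    show "gbs_primes G' \<subseteq> gbs_primes G"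
      using e' f' w V
      by (intro gbs_primes_subset_if_ends[OF G' G _ unch'] supp_subset_primes)
         (auto simp: joins_def)
    have "supp w \<subseteq> gbs_primes G'"
      using supp_joins(2)[OF G' f'] supp_translate[OF V(1) w(1)] by simp
    then have "supp (snd (p \<oplus> w1)) \<subseteq> gbs_primes G'" "supp (snd (p \<oplus> w)) \<subseteq> gbs_primes G'"
      using supp_w supp_joins(1)[OF G' e'] w by (simp_all add: supp_translate[OF V(3)])
    then show "gbs_primes G \<subseteq> gbs_primes G'"
      using e f supp_joins(1)[OF G' e'] supp_joins(1)[OF G' f']
      by (intro gbs_primes_subset_if_ends[OF G G' D unch])
         (elim insertE emptyE; simp add: joins_def)+
  qed
  have "distinct_edges G' e f"
    using distinct_edgesD[OF G joins_edge[OF e] joins_edge[OF f] dist]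
      unchanged_simps(3)[OF G G' D unch] D
    by (auto simp: distinct_edges_def)
  moreover have "w2 + w1 = scale k w" using k by (simp add: add.commute)
  ultimately show "connection_move G' G"
    unfolding connection_move_def using unch' e f e' f' w Aplus_cong[OF P] by metis
qed

text \<open>
  Adding \<open>w1 + w2\<close> to \<open>q\<close> means going round the new loop \<open>k\<close> times, which restores the first edge.
  The loop at \<open>p\<close> is the new loop at \<open>q\<close>, translated by \<open>w2\<close> and carried over along the new edge.
\<close>

lemma connection_move_conj:
  assumes G: "gbs_graph G" and G': "gbs_graph G'" and move: "connection_move G G'"
    and "conj G x y"
  shows "conj G' x y"
proof -
  from move obtain e f p q k w w1 w2
    where w: "w \<in> Aplus G" "w1 \<in> Aplus G" "w2 \<in> Aplus G"
    and unch: "unchanged_outside {e, f} G G'"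
    and e: "joins G e q (p \<oplus> w1)" and f: "joins G f p (p \<oplus> w)"
    and k: "w1 + w2 = scale k w"
    and e': "joins G' e p (q \<oplus> w2)" and f': "joins G' f q (q \<oplus> w)"
    unfolding connection_move_def by blast
  note P = connection_move_sym(1)[OF G G' move]
  have A: "Aplus G = Aplus G'" using Aplus_cong[OF P] by simp
  note w = w[unfolded A]
  note [trans] = conj_trans[OF G']
  have link: "conj G' (q \<oplus> w2) p" using conj_sym[OF G' conj_joins[OF G' e']] .
  have loop: "conj G' q (q \<oplus> w)" using conj_joins[OF G' f'] .
  have "conj G' q (q \<oplus> scale k w)" by (rule conj_scale[OF G' w(1) loop])
  also have "q \<oplus> scale k w = q \<oplus> w2 \<oplus> w1" by (simp add: add.commute flip: k)
  also have "conj G' (q \<oplus> w2 \<oplus> w1) (p \<oplus> w1)" by (rule conj_translate[OF G' w(2) link])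
  finally have ends_e: "conj G' q (p \<oplus> w1)" .
  have "conj G' p (q \<oplus> w2)" using conj_joins[OF G' e'] .
  also have "conj G' (q \<oplus> w2) (q \<oplus> w \<oplus> w2)" by (rule conj_translate[OF G' w(3) loop])
  also have "q \<oplus> w \<oplus> w2 = q \<oplus> w2 \<oplus> w" by (simp add: add.commute)
  also have "conj G' (q \<oplus> w2 \<oplus> w) (p \<oplus> w)" by (rule conj_translate[OF G' w(1) link])
  finally have ends_f: "conj G' p (p \<oplus> w)" .
  show ?thesis
    using e f ends_e ends_f
    by (intro conj_imp_conj_if_ends[OF G G' _ unch P _ assms(4)]) (auto simp: joins_def)
qed

lemma conj_preserving_slide:
  assumes G: "gbs_graph G" and G': "gbs_graph G'" and move: "slide_move G G'"
  shows "conj_preserving id id G G'"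
proof -
  from move obtain e f p q r a where unch: "unchanged_outside {f} G G'"
    and f: "joins G f r (p \<oplus> a)" and f': "joins G' f r (q \<oplus> a)"
    unfolding slide_move_def by blast
  have D: "{f} \<subseteq> edges G" using f by (simp add: joins_def)
  note us = unchanged_simps[OF G G' D unch]
  have conj_eq: "conj G' x y \<longleftrightarrow> conj G x y" for x y
    using slide_move_conj G G' move slide_move_sym(2)[OF G G' move] by blast
  have "conj G r (p \<oplus> a)" "conj G r (q \<oplus> a)"
    using conj_joins[OF G f] conj_joins[OF G' f'] conj_eq by auto
  then have f_ends: "conj G r r" "conj G (p \<oplus> a) (q \<oplus> a)"
    using G by (meson conj_sym conj_trans)+
  have "conj G (aff_init G x) (aff_init G' x)" if x: "x \<in> edges G" for x
  proof -
    consider "x = f" | "x = opp G f" | "x \<notin> {f}" "x \<notin> opp G ` {f}" by auto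
    then show ?thesis
    proof cases
      case 2
      then have "x = opp G' f" using us(3) D by simp
      with 2 show ?thesis
        using f f' f_ends G G' aff_init_opp[of G f] aff_init_opp[of G' f] by (simp add: joins_def)
    next
      case 3
      then show ?thesis using unchanged_ends(2)[OF G G' D unch x] x G by (simp add: conj_refl)
    qed (use f f' f_ends in \<open>simp add: joins_def\<close>)
  qed
  then show ?thesis
    using slide_move_sym(1)[OF G G' move] by (simp add: conj_preserving_def conj_eq us)
qed

text \<open>
  This is the common shape of swaps and connections: \<open>e\<close> and \<open>f\<close> take over each other's initial
  vertices. The other endpoints need no separate hypothesis, since they are conjugate to the
  initial ones and conjugacy is the same in both graphs.
\<close>

lemma conj_preserving_exchange:
  assumes G: "gbs_graph G" and G': "gbs_graph G'"
    and unch: "unchanged_outside {e, f} G G'" and dist: "distinct_edges G e f"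
    and e: "joins G e p q" and f: "joins G f r s"
    and e': "joins G' e r s'" and f': "joins G' f p q'"
    and P: "gbs_primes G' = gbs_primes G" and conj_eq: "\<And>x y. conj G' x y \<longleftrightarrow> conj G x y"
  shows "conj_preserving id (transpose e f \<circ> transpose (opp G e) (opp G f)) G G'"
proof -
  let ?\<sigma> = "transpose e f \<circ> transpose (opp G e) (opp G f)"
  have D: "{e, f} \<subseteq> edges G" using e f by (simp add: joins_def)
  then have ef: "e \<in> edges G" "f \<in> edges G" by auto
  note us = unchanged_simps[OF G G' D unch]
  note d = distinct_edgesD[OF G ef dist] opp_neq[OF G ef(1)] opp_neq[OF G ef(2)]
  have \<sigma>: "bij_betw ?\<sigma> (edges G) (edges G)"
    by (rule bij_betw_trans[where B = "edges G"]; rule bij_betw_transpose_iff)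
       (simp_all add: ef opp_edges[OF G])
  have c: "conj G p q" "conj G r s" "conj G r s'" "conj G p q'"
    using conj_joins[OF G e] conj_joins[OF G f] conj_joins[OF G' e'] conj_joins[OF G' f'] conj_eq
    by auto
  then have ends: "conj G p p" "conj G r r" "conj G q q'" "conj G s s'"
    using G by (meson conj_sym conj_trans)+
  have opp_ends: "aff_init G' (opp G f) = q'" "aff_init G' (opp G e) = s'"
    using aff_init_opp[OF G', of f] aff_init_opp[OF G', of e] e' f' ef us
    by (simp_all add: joins_def)
  have "conj G (aff_init G x) (aff_init G' (?\<sigma> x))" if x: "x \<in> edges G" for x
  proof -
    consider "x = e" | "x = f" | "x = opp G e" | "x = opp G f"
      | "x \<notin> {e, f}" "x \<notin> opp G ` {e, f}" by auto
    then show ?thesis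
    proof cases
      case 1
      then have "?\<sigma> x = f" using d by (simp add: transpose_def)
      with 1 show ?thesis using e f' ends by (simp add: joins_def)
    next
      case 2
      then have "?\<sigma> x = e" using d by (auto simp: transpose_def)
      with 2 show ?thesis using f e' ends by (simp add: joins_def)
    next
      case 3
      then have "?\<sigma> x = opp G f" using d by (auto simp: transpose_def)
      with 3 show ?thesis using e opp_ends ends G by (simp add: joins_def)
    next
      case 4
      then have "?\<sigma> x = opp G e" using d by (auto simp: transpose_def)
      with 4 show ?thesis using f opp_ends ends G by (simp add: joins_def)
    next
      case 5
      then have "?\<sigma> x = x" by (auto simp: transpose_def)
      with 5 show ?thesis
        using unchanged_ends(2)[OF G G' D unch x] x G by (simp add: conj_refl)
    qed
  qed
  then show ?thesis
    using P \<sigma> by (simp add: conj_preserving_def conj_eq us)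
qed

lemma conj_preserving_move:
  assumes "gbs_move G G'"
  shows "\<exists>\<sigma>. conj_preserving id \<sigma> G G'"
proof -
  have G: "gbs_graph G" and G': "gbs_graph G'" using assms by (auto simp: gbs_move_def)
  consider "slide_move G G'" | "swap_move G G'" | "connection_move G G'"
    using assms by (auto simp: gbs_move_def)
  then show ?thesis
  proof cases
    case 1
    then show ?thesis using conj_preserving_slide[OF G G'] by blast
  next
    case 2
    note sym = swap_move_sym[OF G G' 2]
    have "conj G' x y \<longleftrightarrow> conj G x y" for x y
      using swap_move_conj G G' 2 sym(2) by blast
    with 2 show ?thesis
      unfolding swap_move_def using conj_preserving_exchange[OF G G' _ _ _ _ _ _ sym(1)] by blast
  next
    case 3
    note sym = connection_move_sym[OF G G' 3]
    have "conj G' x y \<longleftrightarrow> conj G x y" for x y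
      using connection_move_conj G G' 3 sym(2) by blast
    with 3 show ?thesis
      unfolding connection_move_def
      using conj_preserving_exchange[OF G G' _ _ _ _ _ _ sym(1)] by blast
  qed
qed

lemma conj_preserving_moves:
  assumes "gbs_graph G" "gbs_move\<^sup>*\<^sup>* G H"
  shows "gbs_graph H \<and> (\<exists>\<sigma>. conj_preserving id \<sigma> G H)"
  using assms(2)
proof induction
  case base
  then show ?case using assms(1) conj_preserving_refl by blast
next
  case (step H K)
  then obtain \<sigma> \<rho> where "conj_preserving id \<sigma> G H" "conj_preserving id \<rho> H K"
    using conj_preserving_move by blast
  moreover have K: "gbs_graph K" using step.hyps(2) by (simp add: gbs_move_def)
  ultimately have "conj_preserving (id \<circ> id) (\<rho> \<circ> \<sigma>) G K"
    using conj_preserving_trans[OF assms(1)] by blast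
  with K show ?case unfolding comp_id by blast
qed

section \<open>Isomorphisms of GBS graphs\<close>

text \<open>
  An isomorphism carries steps of \<open>G\<close> to steps of \<open>G'\<close>. Conversely, steps of \<open>G'\<close> that start at an
  image point lift to \<open>G\<close>, so affine paths do.
\<close>

lemma conj_preserving_iso:
  assumes G: "gbs_graph G" and G': "gbs_graph G'" and iso: "gbs_iso \<phi> \<epsilon> G G'"
  shows "conj_preserving \<phi> \<epsilon> G G'"
proof -
  have \<phi>: "bij_betw \<phi> (verts G) (verts G')" and \<epsilon>: "bij_betw \<epsilon> (edges G) (edges G')"
    using iso by (auto simp: gbs_iso_def)
  have "edges G' = \<epsilon> ` edges G" using \<epsilon> by (simp add: bij_betw_def)
  then have P: "gbs_primes G' = gbs_primes G"
    using iso by (auto simp: gbs_primes_def gbs_iso_def)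
  have terms: "aff_term G' (\<epsilon> x) = map_pt \<phi> (aff_term G x)" if "x \<in> edges G" for x
    using iso that opp_edges[OF G that]
    by (simp add: gbs_iso_def aff_term_def terminus_def map_pt_def) metis
  have inits: "aff_init G' (\<epsilon> x) = map_pt \<phi> (aff_init G x)" if "x \<in> edges G" for x
    using iso that opp_edges[OF G that] terms unfolding gbs_iso_def aff_init_def by metis
  have m: "bij_betw (map_pt \<phi>) (aff_verts G) (aff_verts G')"
    by (rule bij_betw_map_pt[OF P \<phi>])
  have A: "Aplus G' = Aplus G" by (rule Aplus_cong[OF P])
  have "conj G' (map_pt \<phi> p) (map_pt \<phi> q)" if "conj G p q" for p q
  proof -
    have step: "aff_step G' (map_pt \<phi> u) (map_pt \<phi> v)" if "aff_step G u v" for u v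
      using that \<epsilon> terms inits A unfolding aff_step_def bij_betw_def
      by (metis imageI map_pt_translate)
    have "(aff_step G)\<^sup>*\<^sup>* p q" using that G by (simp add: conj_iff_aff_steps)
    then have "(aff_step G')\<^sup>*\<^sup>* (map_pt \<phi> p) (map_pt \<phi> q)"
      by induction (auto intro: rtranclp.rtrancl_into_rtrancl step)
    then show ?thesis
      using bij_betw_apply[OF m conj_verts(1)[OF that]] by (simp add: conj_iff_aff_steps[OF G'])
  qed
  moreover have "conj G p q"
    if "conj G' (map_pt \<phi> p) (map_pt \<phi> q)" "p \<in> aff_verts G" "q \<in> aff_verts G" for p q
  proof -
    have lift: "\<exists>v\<in>aff_verts G. map_pt \<phi> v = v' \<and> aff_step G u v"
      if "aff_step G' (map_pt \<phi> u) v'" "u \<in> aff_verts G" for u v'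
    proof -
      from that obtain x w where x: "x \<in> edges G" "w \<in> Aplus G"
        "map_pt \<phi> u = map_pt \<phi> (aff_init G x \<oplus> w)" "v' = map_pt \<phi> (aff_term G x \<oplus> w)"
        unfolding aff_step_def A \<open>edges G' = \<epsilon> ` edges G\<close> by (auto simp: terms inits)
      moreover have "u = aff_init G x \<oplus> w"
        using inj_onD[OF bij_betw_imp_inj_on[OF m] x(3) that(2)] x G by simp
      ultimately have "aff_step G u (aff_term G x \<oplus> w)" unfolding aff_step_def by blast
      moreover have "aff_term G x \<oplus> w \<in> aff_verts G" using x G by simp
      ultimately show ?thesis using x(4) by blast
    qed
    have "(aff_step G')\<^sup>*\<^sup>* (map_pt \<phi> p) (map_pt \<phi> q)"
      using that G' by (simp add: conj_iff_aff_steps)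
    then have "\<exists>v\<in>aff_verts G. map_pt \<phi> v = map_pt \<phi> q \<and> (aff_step G)\<^sup>*\<^sup>* p v"
    proof induction
      case base
      then show ?case using that by blast
    next
      case (step y z)
      then show ?case by (metis lift rtranclp.rtrancl_into_rtrancl)
    qed
    then obtain v where "v \<in> aff_verts G" "map_pt \<phi> v = map_pt \<phi> q" "(aff_step G)\<^sup>*\<^sup>* p v"
      by blast
    with inj_onD[OF bij_betw_imp_inj_on[OF m] this(2)] that show ?thesis
      by (simp add: conj_iff_aff_steps[OF G])
  qed
  moreover have "conj G' (map_pt \<phi> (aff_init G x)) (aff_init G' (\<epsilon> x))" if "x \<in> edges G" for x
    using that inits bij_betw_apply[OF m aff_init_in[OF G that]] by (simp add: conj_refl)
  ultimately show ?thesis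
    using P \<phi> \<epsilon> unfolding conj_preserving_def by blast
qed

section \<open>Invariance of the linear invariants\<close>

theorem theorem2:
  fixes G :: "('v, 'e) gbs" and G' :: "('w, 'f) gbs" and \<phi> :: "'v \<Rightarrow> 'w"
  assumes "gbs_graph G" and "gbs_graph G'"
    and "moves_inducing \<phi> G G'"
  shows "qc_classes G' = (`) (map_pt \<phi>) ` qc_classes G \<and>
         linear_invariants G' = map_lin_inv \<phi> (linear_invariants G)"
proof -
  from assms(3) obtain H \<epsilon> where H: "gbs_move\<^sup>*\<^sup>* G H" and iso: "gbs_iso \<phi> \<epsilon> H G'"
    by (auto simp: moves_inducing_def)
  from conj_preserving_moves[OF assms(1) H] obtain \<sigma>
    where "gbs_graph H" "conj_preserving id \<sigma> G H" by blast
  then have "conj_preserving (\<phi> \<circ> id) (\<epsilon> \<circ> \<sigma>) G G'"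
    using conj_preserving_trans assms(1,2) conj_preserving_iso[OF _ assms(2) iso] by blast
  then show ?thesis
    using preserved_qc_classes[OF assms(1,2)] preserved_linear_invariants[OF assms(1,2)] by simp
qed

end
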